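(* Fix $\delta\in(0,1)$ and $\varepsilon\in(0,1/2)$, and let $L=\lfloor N^\delta\rfloor$. Let $D$ be an $N\times N$ matrix and $\lambda$ a choice model on $S_N$ with $\|D-M(\lambda)\|_2\le\varepsilon$, where either (1) $\lambda=\mathbb P_w$ is an MNL model with parameters $0<w_1<w_2<\dots<w_N$ satisfying $\dfrac{w_N}{\sum_{k=1}^{N-L}w_k}\le\dfrac{\sqrt{\log N}}{N}$; or (2) $\lambda=\mathbb P_\theta$ is an exponential family model whose parameters satisfy, for any four distinct pairs $(i_1,j_1),(i_2,j_2),(i_3,j_3),(i_4,j_4)\in\{1,\dots,N\}^2$, $\dfrac{\exp(\theta_{i_1j_1}+\theta_{i_2j_2})}{\exp(\theta_{i_3j_3}+\theta_{i_4j_4})}\le\sqrt{\log N}$. Then, for all $N$ sufficiently large (depending on $\delta,\varepsilon$), there exists a choice model $\hat\lambda$ in the signature family with $\|D-M(\hat\lambda)\|_2\le 2\varepsilon$ and $\|\hat\lambda\|_0=O(N/\varepsilon^2)$ (one may take $\|\hat\lambda\|_0\le 4N/\varepsilon^2$).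
   Context: $S_N$ is the set of permutations of $\{1,\dots,N\}$, $\sigma(i)$ the rank of item $i$, $\sigma^{-1}(j)$ the item at rank $j$. A choice model is a probability distribution on $S_N$; $\|\lambda\|_0$ is its support size; $M_{ij}(\lambda)=\sum_\sigma\lambda(\sigma)\mathbf 1_{\{\sigma(i)=j\}}$; $\|A\|_2=(\sum_{i,j}A_{ij}^2)^{1/2}$. Signature family: $\lambda$ is in it if for every $\sigma$ in the support there is $(i,j)$ with $\sigma(i)=j$ and $\sigma'(i)\ne j$ for every other $\sigma'$ in the support. MNL model with parameters $w_1,\dots,w_N>0$: $\mathbb P_w(\sigma)=\prod_{j=1}^N\frac{w_{\sigma^{-1}(j)}}{w_{\sigma^{-1}(j)}+w_{\sigma^{-1}(j+1)}+\dots+w_{\sigma^{-1}(N)}}$. Exponential family with parameters $\theta\in\mathbb R^{N\times N}$: $\mathbb P_\theta(\sigma)=Z(\theta)^{-1}\exp(\sum_{i,j}\theta_{ij}\sigma_{ij})$, where $\sigma_{ij}=\mathbf 1_{\{\sigma(i)=j\}}$ and $Z(\theta)=\sum_{\sigma\in S_N}\exp(\sum_{i,j}\theta_{ij}\sigma_{ij})$. *)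

theory Defs
  imports "HOL-Analysis.Analysis" "HOL-Combinatorics.Permutations"
begin

text \<open>Permutations of {1..N} are functions sigma with sigma permutes {1..N};
 sigma i is the rank of item i, inv sigma j is the item at rank j.
 A choice model is a function on permutations, zero outside S_N.\<close>

definition perms :: "nat \<Rightarrow> (nat \<Rightarrow> nat) set" where
  "perms N = {\<sigma>. \<sigma> permutes {1..N}}"

definition choice_model :: "nat \<Rightarrow> ((nat \<Rightarrow> nat) \<Rightarrow> real) \<Rightarrow> bool" where
  "choice_model N lam \<longleftrightarrow> (\<forall>\<sigma>. lam \<sigma> \<ge> 0) \<and> (\<forall>\<sigma>. \<sigma> \<notin> perms N \<longrightarrow> lam \<sigma> = 0)
     \<and> (\<Sum>\<sigma>\<in>perms N. lam \<sigma>) = 1"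

definition support :: "nat \<Rightarrow> ((nat \<Rightarrow> nat) \<Rightarrow> real) \<Rightarrow> (nat \<Rightarrow> nat) set" where
  "support N lam = {\<sigma>\<in>perms N. lam \<sigma> \<noteq> 0}"

definition support_size :: "nat \<Rightarrow> ((nat \<Rightarrow> nat) \<Rightarrow> real) \<Rightarrow> nat" where
  "support_size N lam = card (support N lam)"

definition first_order_matrix :: "nat \<Rightarrow> ((nat \<Rightarrow> nat) \<Rightarrow> real) \<Rightarrow> nat \<Rightarrow> nat \<Rightarrow> real" where
  "first_order_matrix N lam i j = (\<Sum>\<sigma>\<in>perms N. lam \<sigma> * (if \<sigma> i = j then 1 else 0))"

definition frob_dist :: "nat \<Rightarrow> (nat \<Rightarrow> nat \<Rightarrow> real) \<Rightarrow> (nat \<Rightarrow> nat \<Rightarrow> real) \<Rightarrow> real" where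
  "frob_dist N A B = sqrt (\<Sum>i\<in>{1..N}. \<Sum>j\<in>{1..N}. (A i j - B i j)^2)"

definition signature_family :: "nat \<Rightarrow> ((nat \<Rightarrow> nat) \<Rightarrow> real) \<Rightarrow> bool" where
  "signature_family N lam \<longleftrightarrow> (\<forall>\<sigma>\<in>support N lam. \<exists>i\<in>{1..N}. \<exists>j\<in>{1..N}.
      \<sigma> i = j \<and> (\<forall>\<sigma>'\<in>support N lam. \<sigma>' \<noteq> \<sigma> \<longrightarrow> \<sigma>' i \<noteq> j))"

definition mnl :: "nat \<Rightarrow> (nat \<Rightarrow> real) \<Rightarrow> (nat \<Rightarrow> nat) \<Rightarrow> real" where
  "mnl N w \<sigma> = (if \<sigma> \<in> perms N then
      (\<Prod>j\<in>{1..N}. w (inv \<sigma> j) / (\<Sum>k\<in>{j..N}. w (inv \<sigma> k))) else 0)"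

definition expfam_Z :: "nat \<Rightarrow> (nat \<Rightarrow> nat \<Rightarrow> real) \<Rightarrow> real" where
  "expfam_Z N \<theta> = (\<Sum>\<sigma>\<in>perms N. exp (\<Sum>i\<in>{1..N}. \<Sum>j\<in>{1..N}. \<theta> i j * (if \<sigma> i = j then 1 else 0)))"

definition expfam :: "nat \<Rightarrow> (nat \<Rightarrow> nat \<Rightarrow> real) \<Rightarrow> (nat \<Rightarrow> nat) \<Rightarrow> real" where
  "expfam N \<theta> \<sigma> = (if \<sigma> \<in> perms N then
      exp (\<Sum>i\<in>{1..N}. \<Sum>j\<in>{1..N}. \<theta> i j * (if \<sigma> i = j then 1 else 0)) / expfam_Z N \<theta> else 0)"

end

theory Submission
  imports Defs "HOL-Combinatorics.Multiset_Permutations" "HOL-Real_Asymp.Real_Asymp"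
begin

text \<open>
  Both models give each item probability at most \<open>sqrt (ln N) / N\<close> of holding any one of the first
  \<open>r = \<lfloor>8 / \<epsilon>\<^sup>2\<rfloor>\<close> ranks.  By Maurey's empirical method, the average of \<open>K \<approx> r N / 2\<close> suitably chosen
  permutations approximates the first-order matrix within about \<open>sqrt (N / K) \<approx> \<epsilon> / 2\<close>.  Overwriting
  the first \<open>r\<close> ranks of the chosen permutations in a prescribed pattern gives each of them a private
  cell there and moves at most \<open>2 r\<close> items in each.  As no item is moved in more than \<open>o(N)\<close> of the
  permutations, this changes the average by only \<open>o(1)\<close> in Frobenius norm.
\<close>

section \<open>Empirical approximation of a mean\<close>

text \<open>Maurey's samples may repeat and need not have private cells. As \<open>r\<close> does
  not depend on \<open>N\<close>, reserving \<open>r\<close> whole rank columns is cheap, and about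
  half of the items in each column already supply \<open>r * h\<close> cells, one per sample. The
  value of \<open>r\<close> balances two demands: the sampling error tends to
  \<open>sqrt (2 / r)\<close>, which must lie below \<epsilon>, and the support size is at most
  \<open>r * N / 2\<close>, which must not exceed \<open>4 * N / \<epsilon>\<^sup>2\<close>. The
  danger is an item that sits at a top rank in a positive fraction of the samples: evicting it each
  time would change an entry by a constant. The bound \<open>sqrt (ln N) / N\<close> excludes this
  for expected counts, but the plain Frobenius estimate lets a single count deviate by order
  \<open>N\<close>, as much as the number of samples. Hence the samples are chosen to control a
  weighted norm in which the top columns get extra weight \<open>sqrt N\<close>; counts there become
  \<open>O(N powr (3/4))\<close>, at the price of a lower-order term in the total error.\<close>

lemma exists_le_weighted_mean:
  fixes p F :: "'a \<Rightarrow> real"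
  assumes "finite A" "\<And>x. x \<in> A \<Longrightarrow> 0 \<le> p x" "sum p A = 1"
    and mean: "(\<Sum>x\<in>A. p x * F x) \<le> c"
  shows "\<exists>x\<in>A. F x \<le> c"
proof (rule ccontr)
  assume "\<not> ?thesis"
  then have gt: "c < F x" if "x \<in> A" for x using that by auto
  obtain y where y: "y \<in> A" "p y \<noteq> 0"
    using assms(3) by (metis sum.neutral zero_neq_one)
  have "c = (\<Sum>x\<in>A. p x * c)"
    using assms(3) by (simp add: sum_distrib_right[symmetric])
  also have "\<dots> < (\<Sum>x\<in>A. p x * F x)"
  proof (rule sum_strict_mono_ex1)
    show "\<forall>x\<in>A. p x * c \<le> p x * F x"
      using gt assms(2) by (auto intro!: mult_left_mono intro: less_imp_le)
    show "\<exists>x\<in>A. p x * c < p x * F x"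
      using y gt[OF y(1)] assms(2)[OF y(1)] by (intro bexI[of _ y]) auto
  qed fact
  finally show False using mean by simp
qed

text \<open>The deviation of \<open>Y\<close> from its mean is centred, so the cross term with
  \<open>a\<close> vanishes; what is added to the square of \<open>a\<close> is the variance of
  \<open>Y\<close>.\<close>

lemma weighted_square_expansion:
  fixes p Y :: "'a \<Rightarrow> real"
  assumes "sum p A = 1"
  shows "(\<Sum>x\<in>A. p x * (a + Y x - (\<Sum>x\<in>A. p x * Y x))\<^sup>2)
    = a\<^sup>2 - (\<Sum>x\<in>A. p x * Y x)\<^sup>2 + (\<Sum>x\<in>A. p x * (Y x)\<^sup>2)"
proof -
  define m where "m = (\<Sum>x\<in>A. p x * Y x)"
  have "(\<Sum>x\<in>A. p x * (a + Y x - m)\<^sup>2)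
      = (\<Sum>x\<in>A. (a - m)\<^sup>2 * p x + 2 * (a - m) * (p x * Y x) + p x * (Y x)\<^sup>2)"
    by (intro sum.cong refl) (simp add: power2_eq_square algebra_simps)
  also have "\<dots> = (a - m)\<^sup>2 * sum p A + 2 * (a - m) * m + (\<Sum>x\<in>A. p x * (Y x)\<^sup>2)"
    by (simp add: sum.distrib sum_distrib_left m_def)
  also have "\<dots> = a\<^sup>2 - m\<^sup>2 + (\<Sum>x\<in>A. p x * (Y x)\<^sup>2)"
    using assms by (simp add: power2_eq_square algebra_simps)
  finally show ?thesis unfolding m_def .
qed

text \<open>Maurey's empirical method, derandomised by choosing the samples one after another.\<close>

lemma empirical_mean_approximation:
  fixes p :: "'a \<Rightarrow> real" and X :: "'a \<Rightarrow> 'b \<Rightarrow> real" and W :: "'b \<Rightarrow> real"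
  assumes "finite A" "\<And>x. x \<in> A \<Longrightarrow> 0 \<le> p x" "sum p A = 1"
    and W: "\<And>c. c \<in> C \<Longrightarrow> 0 \<le> W c" and "finite I"
  shows "\<exists>f. (\<forall>k\<in>I. f k \<in> A) \<and>
    (\<Sum>c\<in>C. W c * ((\<Sum>k\<in>I. X (f k) c) - real (card I) * (\<Sum>x\<in>A. p x * X x c))\<^sup>2)
      \<le> real (card I) * (\<Sum>c\<in>C. W c * (\<Sum>x\<in>A. p x * (X x c)\<^sup>2))"
  using \<open>finite I\<close>
proof (induction I rule: finite_induct)
  case empty
  then show ?case by simp
next
  case (insert k I)
  define M where "M c = (\<Sum>x\<in>A. p x * X x c)" for c
  define V where "V = (\<Sum>c\<in>C. W c * (\<Sum>x\<in>A. p x * (X x c)\<^sup>2))"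
  obtain f where f: "\<forall>k\<in>I. f k \<in> A"
      "(\<Sum>c\<in>C. W c * ((\<Sum>k\<in>I. X (f k) c) - real (card I) * M c)\<^sup>2) \<le> real (card I) * V"
    using insert.IH unfolding M_def V_def by blast
  \<comment> \<open>This is the error accumulated so far. Averaged over one further draw, its
    weighted square grows by at most \<open>V\<close> (the negative square of the mean is dropped),
    so some single \<open>x\<close> does no worse.\<close>
  define e where "e c = (\<Sum>k\<in>I. X (f k) c) - real (card I) * M c" for c
  have "(\<Sum>x\<in>A. p x * (\<Sum>c\<in>C. W c * (e c + X x c - M c)\<^sup>2))
      = (\<Sum>c\<in>C. W c * (\<Sum>x\<in>A. p x * (e c + X x c - M c)\<^sup>2))"
    by (simp add: sum_distrib_left mult.left_commute sum.swap[of _ C A])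
  also have "\<dots> \<le> (\<Sum>c\<in>C. W c * ((e c)\<^sup>2 + (\<Sum>x\<in>A. p x * (X x c)\<^sup>2)))"
    unfolding M_def weighted_square_expansion[OF assms(3)]
    by (intro sum_mono mult_left_mono W) auto
  also have "\<dots> = (\<Sum>c\<in>C. W c * (e c)\<^sup>2) + V"
    by (simp add: V_def distrib_left sum.distrib)
  also have "\<dots> \<le> real (card I) * V + V"
    using f(2) by (simp add: e_def)
  finally have mean: "(\<Sum>x\<in>A. p x * (\<Sum>c\<in>C. W c * (e c + X x c - M c)\<^sup>2))
      \<le> real (card I) * V + V" .
  obtain x where x: "x \<in> A"
      "(\<Sum>c\<in>C. W c * (e c + X x c - M c)\<^sup>2) \<le> real (card I) * V + V"
    using exists_le_weighted_mean[OF assms(1) _ assms(3) mean] assms(2) by blast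
  define g where "g = f(k := x)"
  have g: "(\<Sum>l\<in>insert k I. X (g l) c) = X x c + (\<Sum>l\<in>I. X (f l) c)" for c
    using insert.hyps by (auto simp: g_def intro!: sum.cong)
  have "(\<Sum>c\<in>C. W c * ((\<Sum>l\<in>insert k I. X (g l) c) - real (card (insert k I)) * M c)\<^sup>2)
      = (\<Sum>c\<in>C. W c * (e c + X x c - M c)\<^sup>2)"
    using insert.hyps unfolding g by (simp add: e_def algebra_simps)
  also have "\<dots> \<le> real (card (insert k I)) * V"
    using x(2) insert.hyps by (simp add: algebra_simps)
  finally have "(\<Sum>c\<in>C. W c * ((\<Sum>l\<in>insert k I. X (g l) c) - real (card (insert k I)) * M c)\<^sup>2)
      \<le> real (card (insert k I)) * V" .
  moreover have "\<forall>l\<in>insert k I. g l \<in> A"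
    using f(1) x(1) by (simp add: g_def)
  ultimately show ?case unfolding M_def V_def by blast
qed

section \<open>Prescribing the items at the top ranks\<close>

text \<open>Ranks are settled one at a time by exchanging rank \<open>Suc n\<close> with the present
  rank of \<open>\<beta> (Suc n)\<close>; earlier assignments involve neither rank. An item outside
  the prescription moves only when evicted from a rank up to \<open>r\<close>, which explains the
  guard \<open>r < \<sigma> i\<close> and leaves at most \<open>2 * r\<close> items
  displaced.\<close>

lemma permutes_prescribe_top:
  fixes \<sigma> \<beta> :: "nat \<Rightarrow> nat"
  assumes \<sigma>: "\<sigma> permutes {1..N}" and "r \<le> N"
    and \<beta>: "\<beta> ` {1..r} \<subseteq> {1..N}" "inj_on \<beta> {1..r}"
  shows "\<exists>\<tau>. \<tau> permutes {1..N} \<and> (\<forall>j\<in>{1..r}. \<tau> (\<beta> j) = j) \<and>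
    (\<forall>i. i \<notin> \<beta> ` {1..r} \<longrightarrow> r < \<sigma> i \<longrightarrow> \<tau> i = \<sigma> i)"
  using assms(2-)
proof (induction r)
  case 0
  then show ?case using \<sigma> by auto
next
  case (Suc n)
  have "\<beta> ` {1..n} \<subseteq> {1..N}" "inj_on \<beta> {1..n}"
    using Suc.prems by (auto intro: inj_on_subset)
  then obtain \<tau> where \<tau>: "\<tau> permutes {1..N}" "\<forall>j\<in>{1..n}. \<tau> (\<beta> j) = j"
      "\<forall>i. i \<notin> \<beta> ` {1..n} \<longrightarrow> n < \<sigma> i \<longrightarrow> \<tau> i = \<sigma> i"
    using Suc.IH Suc.prems(1) by auto
  define \<rho> where "\<rho> = Transposition.transpose (Suc n) (\<tau> (\<beta> (Suc n))) \<circ> \<tau>"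
  have b: "\<beta> (Suc n) \<in> {1..N}" using Suc.prems(2) by (auto simp: image_subset_iff)
  have "\<rho> permutes {1..N}"
    unfolding \<rho>_def
    using \<tau>(1) b Suc.prems(1) permutes_in_image[OF \<tau>(1)]
    by (intro permutes_compose permutes_swap_id) auto
  moreover have "\<rho> (\<beta> j) = j" if j: "j \<in> {1..Suc n}" for j
  proof (cases "j = Suc n")
    case False
    then have jn: "j \<in> {1..n}" using j by auto
    have "\<beta> j \<noteq> \<beta> (Suc n)"
      using inj_onD[OF Suc.prems(3), of j "Suc n"] j False by auto
    then have "\<tau> (\<beta> j) \<noteq> \<tau> (\<beta> (Suc n))"
      using permutes_inj[OF \<tau>(1)] by (auto dest: injD)
    then show ?thesis using \<tau>(2) jn by (auto simp: \<rho>_def Transposition.transpose_def)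
  qed (simp add: \<rho>_def)
  moreover have "\<rho> i = \<sigma> i" if i: "i \<notin> \<beta> ` {1..Suc n}" "Suc n < \<sigma> i" for i
  proof -
    have "i \<notin> \<beta> ` {1..n}" "i \<noteq> \<beta> (Suc n)" using i(1) by auto
    then have "\<tau> i = \<sigma> i" "\<tau> i \<noteq> \<tau> (\<beta> (Suc n))"
      using \<tau>(3) i(2) inj_eq[OF permutes_inj[OF \<tau>(1)]] by auto
    then show ?thesis using i(2) by (auto simp: \<rho>_def Transposition.transpose_def)
  qed
  ultimately show ?case by blast
qed

text \<open>A sum of squares is at most the largest absolute entry times the sum of absolute
  entries. An entry in row \<open>i\<close> is bounded by the number of \<open>k\<close> that move
  \<open>i\<close>, and each move contributes at most 2 to the absolute sum: the cell left and the
  cell entered.\<close>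

lemma sum_square_count_difference:
  fixes f g :: "'k \<Rightarrow> nat \<Rightarrow> nat"
  assumes "finite I" and m0: "0 \<le> m"
    and moved: "\<And>k. k \<in> I \<Longrightarrow> card {i\<in>{1..N}. f k i \<noteq> g k i} \<le> c"
    and often: "\<And>i. i \<in> {1..N} \<Longrightarrow> real (card {k\<in>I. f k i \<noteq> g k i}) \<le> m"
  shows "(\<Sum>i\<in>{1..N}. \<Sum>j\<in>{1..N}.
      ((\<Sum>k\<in>I. of_bool (f k i = j)) - (\<Sum>k\<in>I. of_bool (g k i = j)))\<^sup>2)
    \<le> m * (2 * real c * real (card I))"
proof -
  define E :: "nat \<Rightarrow> nat \<Rightarrow> real" where
    "E i j = (\<Sum>k\<in>I. of_bool (f k i = j)) - (\<Sum>k\<in>I. of_bool (g k i = j))" for i j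
  define d :: "'k \<Rightarrow> nat \<Rightarrow> nat \<Rightarrow> real" where
    "d k i j = \<bar>of_bool (f k i = j) - of_bool (g k i = j)\<bar>" for k i j
  have E: "\<bar>E i j\<bar> \<le> (\<Sum>k\<in>I. d k i j)" for i j
    unfolding E_def d_def sum_subtractf[symmetric] by (rule sum_abs)
  have Em: "\<bar>E i j\<bar> \<le> m" if "i \<in> {1..N}" for i j
  proof -
    have "\<bar>E i j\<bar> \<le> (\<Sum>k\<in>I. of_bool (f k i \<noteq> g k i))"
      by (rule order.trans[OF E]) (auto intro!: sum_mono simp: d_def)
    also have "\<dots> = real (card {k\<in>I. f k i \<noteq> g k i})"
      using assms(1) by (simp add: Int_def)
    finally show ?thesis using often[OF that] by simp
  qed
  have row: "(\<Sum>j\<in>{1..N}. d k i j) \<le> 2 * of_bool (f k i \<noteq> g k i)" for k i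
  proof -
    have "(\<Sum>j\<in>{1..N}. d k i j)
        \<le> (\<Sum>j\<in>{1..N}. of_bool (f k i \<noteq> g k i) * (of_bool (f k i = j) + of_bool (g k i = j)))"
      by (auto intro!: sum_mono simp: d_def)
    also have "\<dots> = of_bool (f k i \<noteq> g k i) *
        (of_bool (f k i \<in> {1..N}) + of_bool (g k i \<in> {1..N}))"
      by (simp add: sum_distrib_left[symmetric] sum.distrib of_bool_def)
    finally show ?thesis by (rule order.trans) auto
  qed
  have "(\<Sum>i\<in>{1..N}. \<Sum>j\<in>{1..N}. (E i j)\<^sup>2) \<le> (\<Sum>i\<in>{1..N}. \<Sum>j\<in>{1..N}. m * (\<Sum>k\<in>I. d k i j))"
  proof (intro sum_mono)
    fix i j assume "i \<in> {1..N}"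
    have "(E i j)\<^sup>2 = \<bar>E i j\<bar> * \<bar>E i j\<bar>" by (simp add: power2_eq_square)
    also have "\<dots> \<le> m * (\<Sum>k\<in>I. d k i j)"
      by (rule mult_mono) (use Em E m0 \<open>i \<in> {1..N}\<close> in auto)
    finally show "(E i j)\<^sup>2 \<le> m * (\<Sum>k\<in>I. d k i j)" .
  qed
  also have "\<dots> = m * (\<Sum>i\<in>{1..N}. \<Sum>j\<in>{1..N}. \<Sum>k\<in>I. d k i j)"
    by (simp add: sum_distrib_left)
  also have "(\<Sum>i\<in>{1..N}. \<Sum>j\<in>{1..N}. \<Sum>k\<in>I. d k i j)
      = (\<Sum>k\<in>I. \<Sum>i\<in>{1..N}. \<Sum>j\<in>{1..N}. d k i j)"
    by (subst sum.swap[of _ I], subst sum.swap[of _ _ I]) (rule refl)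
  also have "m * \<dots> \<le> m * (\<Sum>k\<in>I. \<Sum>i\<in>{1..N}. 2 * of_bool (f k i \<noteq> g k i))"
    by (intro mult_left_mono sum_mono row m0)
  also have "(\<Sum>k\<in>I. \<Sum>i\<in>{1..N}. 2 * of_bool (f k i \<noteq> g k i))
      = (\<Sum>k\<in>I. 2 * real (card {i\<in>{1..N}. f k i \<noteq> g k i}))"
    by (simp add: sum_distrib_left[symmetric] Int_def)
  also have "m * \<dots> \<le> m * (\<Sum>k\<in>I. 2 * real c)"
    using moved by (intro mult_left_mono sum_mono m0) auto
  also have "\<dots> = m * (2 * real c * real (card I))" by simp
  finally show ?thesis unfolding E_def .
qed

section \<open>Choice models and their first-order matrices\<close>

lemma finite_perms: "finite (perms N)"
  unfolding perms_def by (rule finite_permutations) simp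

lemma first_order_matrix_of_bool:
  "first_order_matrix N lam i j = (\<Sum>\<sigma>\<in>perms N. lam \<sigma> * of_bool (\<sigma> i = j))"
  by (simp add: first_order_matrix_def of_bool_def)

lemma sum_of_bool_permutes_eq:
  assumes "\<sigma> permutes A" "finite A" "j \<in> A"
  shows "(\<Sum>i\<in>A. of_bool (\<sigma> i = j) :: real) = 1"
proof -
  have "\<sigma> i = j \<longleftrightarrow> i = inv \<sigma> j" for i
    using permutes_inverses[OF assms(1)] by metis
  then show ?thesis
    using assms permutes_in_image[OF permutes_inv[OF assms(1)]] by simp
qed

lemma first_order_matrix_column_sum:
  assumes "choice_model N lam" "j \<in> {1..N}"
  shows "(\<Sum>i\<in>{1..N}. first_order_matrix N lam i j) = 1"
proof -
  have "(\<Sum>i\<in>{1..N}. first_order_matrix N lam i j)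
      = (\<Sum>\<sigma>\<in>perms N. lam \<sigma> * (\<Sum>i\<in>{1..N}. of_bool (\<sigma> i = j)))"
    unfolding first_order_matrix_of_bool sum_distrib_left by (rule sum.swap)
  also have "\<dots> = (\<Sum>\<sigma>\<in>perms N. lam \<sigma>)"
    using sum_of_bool_permutes_eq[OF _ _ assms(2)]
    by (intro sum.cong refl) (simp add: perms_def)
  finally show ?thesis using assms(1) by (simp add: choice_model_def)
qed

lemma frob_dist_eq_L2_set:
  "frob_dist N A B = L2_set (\<lambda>c. A (fst c) (snd c) - B (fst c) (snd c)) ({1..N} \<times> {1..N})"
  by (simp add: frob_dist_def L2_set_def sum.cartesian_product case_prod_beta)

lemma frob_dist_triangle: "frob_dist N A C \<le> frob_dist N A B + frob_dist N B C"
  using L2_set_triangle_ineq[of "\<lambda>c. A (fst c) (snd c) - B (fst c) (snd c)"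
      "\<lambda>c. B (fst c) (snd c) - C (fst c) (snd c)" "{1..N} \<times> {1..N}"]
  by (simp add: frob_dist_eq_L2_set)

definition uniform_on :: "'a set \<Rightarrow> 'a \<Rightarrow> real" where
  "uniform_on S x = of_bool (x \<in> S) / real (card S)"

lemma sum_uniform_on:
  assumes "finite A" "S \<subseteq> A"
  shows "(\<Sum>x\<in>A. uniform_on S x * F x) = (\<Sum>x\<in>S. F x) / real (card S)"
proof -
  have "(\<Sum>x\<in>A. uniform_on S x * F x) = (\<Sum>x\<in>S. uniform_on S x * F x)"
    using assms by (intro sum.mono_neutral_right) (auto simp: uniform_on_def)
  also have "\<dots> = (\<Sum>x\<in>S. F x) / real (card S)"
    unfolding sum_divide_distrib by (intro sum.cong refl) (simp add: uniform_on_def)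
  finally show ?thesis .
qed

lemma choice_model_uniform_on:
  assumes "S \<subseteq> perms N" "S \<noteq> {}"
  shows "choice_model N (uniform_on S)"
proof -
  have "finite S" using assms(1) finite_perms finite_subset by blast
  then show ?thesis
    using assms sum_uniform_on[OF finite_perms assms(1), of "\<lambda>_. 1"]
    by (auto simp: choice_model_def uniform_on_def)
qed

lemma support_uniform_on:
  assumes "S \<subseteq> perms N"
  shows "support N (uniform_on S) = S"
proof -
  have "finite S" using assms finite_perms finite_subset by blast
  then show ?thesis using assms by (auto simp: support_def uniform_on_def)
qed

text \<open>The weight \<open>1 + s\<close> on the first \<open>r\<close> columns makes the counts there accurate enough to be
  individually small, which controls how often an item is displaced when the top ranks are
  overwritten.  Sample \<open>(q, t)\<close> puts item \<open>t \<le> h\<close> at rank \<open>q\<close> and items larger than \<open>h\<close> at the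
  other top ranks, so the cell \<open>(t, q)\<close> is its signature.\<close>

lemma signature_approximation:
  fixes N r h :: nat and b s :: real
  assumes lam: "choice_model N lam" and rh: "0 < r" "0 < h" "2 * h + r \<le> N" and s: "0 < s"
    and b: "\<And>i j. i \<in> {1..N} \<Longrightarrow> j \<in> {1..r} \<Longrightarrow> first_order_matrix N lam i j \<le> b"
  defines "K \<equiv> real (r * h)"
  defines "m \<equiv> real (r * (r + 1)) + real r * (K * b + sqrt (K * (real N + s * real r) / s))"
  shows "\<exists>lam'. choice_model N lam' \<and> signature_family N lam' \<and> support_size N lam' = r * h \<and>
    frob_dist N (first_order_matrix N lam) (first_order_matrix N lam')
      \<le> sqrt ((real N + s * real r) / K) + sqrt (4 * real r * m / K)"
proof -
  define M where "M = first_order_matrix N lam"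
  define I where "I = {1..r} \<times> {1..h}"
  define C where "C = {1..N} \<times> {1..N}"
  define X :: "(nat \<Rightarrow> nat) \<Rightarrow> nat \<times> nat \<Rightarrow> real" where
    "X \<sigma> c = of_bool (\<sigma> (fst c) = snd c)" for \<sigma> c
  define W where "W c = 1 + s * of_bool (snd c \<in> {1..r})" for c :: "nat \<times> nat"
  define V where "V = real N + s * real r"
  have I: "finite I" "real (card I) = K" "card I = r * h" by (auto simp: I_def K_def)
  have K: "0 < K" using rh by (simp add: K_def)
  have W0: "0 \<le> W c" and W1: "1 \<le> W c" for c using s by (auto simp: W_def)
  have M: "M (fst c) (snd c) = (\<Sum>\<sigma>\<in>perms N. lam \<sigma> * X \<sigma> c)" for c
    by (simp add: M_def X_def first_order_matrix_of_bool)
  \<comment> \<open>For an indicator the second moment is the mean itself, so the variance budget is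
    the weighted total of \<open>M\<close>: each column sums to 1, giving \<open>N\<close>, and the
    first \<open>r\<close> columns add \<open>s\<close> each.\<close>
  have X2: "(X \<sigma> c)\<^sup>2 = X \<sigma> c" for \<sigma> c by (simp add: X_def)
  have "(\<Sum>c\<in>C. W c * M (fst c) (snd c)) = (\<Sum>i\<in>{1..N}. \<Sum>j\<in>{1..N}. W (i, j) * M i j)"
    by (simp add: C_def sum.cartesian_product case_prod_beta)
  also have "\<dots> = (\<Sum>j\<in>{1..N}. (1 + s * of_bool (j \<in> {1..r})) * (\<Sum>i\<in>{1..N}. M i j))"
    by (subst sum.swap) (simp add: W_def sum_distrib_left)
  also have "\<dots> = (\<Sum>j\<in>{1..N}. 1 + s * of_bool (j \<in> {1..r}))"
    using first_order_matrix_column_sum[OF lam] by (intro sum.cong refl) (simp add: M_def)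
  also have "\<dots> = V"
  proof -
    have "(\<Sum>j\<in>{1..N}. of_bool (j \<in> {1..r}) :: real) = real (card ({1..N} \<inter> {1..r}))"
      by (auto simp: Int_def intro!: arg_cong[where f = card])
    also have "{1..N} \<inter> {1..r} = {1..r}" using rh by auto
    finally show ?thesis by (simp add: sum.distrib V_def sum_distrib_left[symmetric])
  qed
  finally have WM: "(\<Sum>c\<in>C. W c * M (fst c) (snd c)) = V" .
  have lam': "finite (perms N)" "\<And>\<sigma>. \<sigma> \<in> perms N \<Longrightarrow> 0 \<le> lam \<sigma>" "sum lam (perms N) = 1"
    using lam finite_perms by (auto simp: choice_model_def)
  obtain f where f: "\<forall>k\<in>I. f k \<in> perms N"
      "(\<Sum>c\<in>C. W c * ((\<Sum>k\<in>I. X (f k) c) - K * M (fst c) (snd c))\<^sup>2) \<le> K * V"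
    using empirical_mean_approximation[where A = "perms N" and p = lam and W = W and C = C
        and I = I and X = X, OF lam'(1) _ lam'(3) W0 I(1)] lam'(2)
    unfolding X2 M[symmetric] I(2) WM by blast
  define S where "S i j = (\<Sum>k\<in>I. of_bool (f k i = j) :: real)" for i j
  have fC: "(\<Sum>i\<in>{1..N}. \<Sum>j\<in>{1..N}. W (i, j) * (S i j - K * M i j)\<^sup>2) \<le> K * V"
    using f(2) by (simp add: C_def S_def X_def sum.cartesian_product case_prod_beta)

  \<comment> \<open>The fillers \<open>h + t + j\<close> lie above every signature item and reach at
    most \<open>2 * h + r\<close>, hence the bound on \<open>h\<close>. The summand \<open>j\<close>
    keeps them distinct within a sample; the summand \<open>t\<close> varies them between samples,
    so that no item serves as filler too often.\<close>
  define \<beta> where "\<beta> k j = (if j = fst k then snd k else h + snd k + j)" for k :: "nat \<times> nat" and j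
  have \<beta>: "\<beta> k ` {1..r} \<subseteq> {1..N}" "inj_on (\<beta> k) {1..r}" if "k \<in> I" for k
    using that rh by (auto simp: \<beta>_def I_def inj_on_def split: if_splits)
  have "\<exists>\<tau>. \<tau> permutes {1..N} \<and> (\<forall>j\<in>{1..r}. \<tau> (\<beta> k j) = j) \<and>
      (\<forall>i. i \<notin> \<beta> k ` {1..r} \<longrightarrow> r < f k i \<longrightarrow> \<tau> i = f k i)" if "k \<in> I" for k
    using that f(1) \<beta>[OF that] rh by (intro permutes_prescribe_top) (auto simp: perms_def)
  then obtain g where g: "\<And>k. k \<in> I \<Longrightarrow> g k permutes {1..N}"
      "\<And>k j. k \<in> I \<Longrightarrow> j \<in> {1..r} \<Longrightarrow> g k (\<beta> k j) = j"
      "\<And>k i. k \<in> I \<Longrightarrow> i \<notin> \<beta> k ` {1..r} \<Longrightarrow> r < f k i \<Longrightarrow> g k i = f k i"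
    by metis

  have signature: "g k' (snd k) \<noteq> fst k" if k: "k \<in> I" "k' \<in> I" "k \<noteq> k'" for k k'
  proof
    assume "g k' (snd k) = fst k"
    moreover have "g k' (\<beta> k' (fst k)) = fst k"
      using g(2)[of k' "fst k"] k by (auto simp: I_def)
    ultimately have "snd k = \<beta> k' (fst k)"
      using permutes_inj[OF g(1)[OF k(2)]] by (metis injD)
    \<comment> \<open>Fillers exceed \<open>h\<close> while \<open>snd k\<close> does not, so rank
      \<open>fst k\<close> must be the signature rank of \<open>k'\<close>; both coordinates then
      agree.\<close>
    then show False
      using k by (auto simp: \<beta>_def I_def prod_eq_iff split: if_splits)
  qed
  have own: "g k (snd k) = fst k" if "k \<in> I" for k
    using g(2)[OF that, of "fst k"] that by (auto simp: \<beta>_def I_def)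
  have inj: "inj_on g I"
    by (rule inj_onI) (metis own signature)

  define lam' where "lam' = uniform_on (g ` I)"
  have gI: "g ` I \<subseteq> perms N" using g(1) by (auto simp: perms_def)
  have card: "card (g ` I) = r * h" using inj I by (simp add: card_image)
  have "I \<noteq> {}" using rh by (auto simp: I_def)
  then have model: "choice_model N lam'"
    unfolding lam'_def using gI by (intro choice_model_uniform_on) auto
  have size: "support_size N lam' = r * h"
    by (simp add: support_size_def lam'_def support_uniform_on[OF gI] card)
  have family: "signature_family N lam'"
    unfolding signature_family_def lam'_def support_uniform_on[OF gI]
  proof
    fix \<sigma> assume "\<sigma> \<in> g ` I"
    then obtain k where k: "k \<in> I" "\<sigma> = g k" by auto
    show "\<exists>i\<in>{1..N}. \<exists>j\<in>{1..N}. \<sigma> i = j \<and> (\<forall>\<sigma>'\<in>g ` I. \<sigma>' \<noteq> \<sigma> \<longrightarrow> \<sigma>' i \<noteq> j)"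
    proof (intro bexI conjI ballI impI)
      show "\<sigma> (snd k) = fst k" using own k by simp
      show "\<sigma>' (snd k) \<noteq> fst k" if "\<sigma>' \<in> g ` I" "\<sigma>' \<noteq> \<sigma>" for \<sigma>'
        using that signature k by (metis imageE)
    qed (use k rh in \<open>auto simp: I_def\<close>)
  qed

  define T where "T i j = (\<Sum>k\<in>I. of_bool (g k i = j) :: real)" for i j
  have M': "first_order_matrix N lam' i j = T i j / K" for i j
    unfolding first_order_matrix_of_bool lam'_def sum_uniform_on[OF finite_perms gI] card
    by (simp add: sum.reindex[OF inj] T_def K_def)

  have "(\<Sum>i\<in>{1..N}. \<Sum>j\<in>{1..N}. (S i j - K * M i j)\<^sup>2)
      \<le> (\<Sum>i\<in>{1..N}. \<Sum>j\<in>{1..N}. W (i, j) * (S i j - K * M i j)\<^sup>2)"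
    using W1 by (intro sum_mono) (simp add: mult_le_cancel_right1)
  then have total: "(\<Sum>i\<in>{1..N}. \<Sum>j\<in>{1..N}. (S i j - K * M i j)\<^sup>2) \<le> K * V"
    using fC by linarith
  \<comment> \<open>A single top cell carries weight at least \<open>s\<close>, so comparing its
    term with the weighted total gains the division by \<open>s\<close> under the root.\<close>
  have top: "S i j \<le> K * b + sqrt (K * V / s)" if ij: "i \<in> {1..N}" "j \<in> {1..r}" for i j
  proof -
    have j: "j \<in> {1..N}" using ij rh by auto
    have "s * (S i j - K * M i j)\<^sup>2 \<le> W (i, j) * (S i j - K * M i j)\<^sup>2"
      using ij by (intro mult_right_mono) (auto simp: W_def)
    also have "\<dots> \<le> (\<Sum>j\<in>{1..N}. W (i, j) * (S i j - K * M i j)\<^sup>2)"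
      using W0 by (intro member_le_sum[OF j, of "\<lambda>j. W (i, j) * (S i j - K * M i j)\<^sup>2"]) auto
    also have "\<dots> \<le> (\<Sum>i\<in>{1..N}. \<Sum>j\<in>{1..N}. W (i, j) * (S i j - K * M i j)\<^sup>2)"
      using W0 by (intro member_le_sum[OF ij(1),
            of "\<lambda>i. \<Sum>j\<in>{1..N}. W (i, j) * (S i j - K * M i j)\<^sup>2"] sum_nonneg) auto
    also have "\<dots> \<le> K * V" by (rule fC)
    finally have "(S i j - K * M i j)\<^sup>2 \<le> K * V / s" using s by (simp add: field_simps)
    then have "\<bar>S i j - K * M i j\<bar> \<le> sqrt (K * V / s)" by (metis real_sqrt_abs real_sqrt_le_iff)
    moreover have "K * M i j \<le> K * b" using b[OF ij] K by (simp add: M_def)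
    ultimately show ?thesis by linarith
  qed

  have moved: "card {i\<in>{1..N}. g k i \<noteq> f k i} \<le> 2 * r" if k: "k \<in> I" for k
  proof -
    have fk: "f k permutes {1..N}" using f(1) k by (auto simp: perms_def)
    have "{i\<in>{1..N}. g k i \<noteq> f k i} \<subseteq> \<beta> k ` {1..r} \<union> inv (f k) ` {1..r}"
    proof
      fix i assume i: "i \<in> {i\<in>{1..N}. g k i \<noteq> f k i}"
      have "f k i \<in> {1..N}" using permutes_in_image[OF fk] i by auto
      moreover have "i \<in> \<beta> k ` {1..r} \<or> f k i \<le> r" using g(3)[OF k] i by force
      moreover have "i = inv (f k) (f k i)" using permutes_inverses[OF fk] by simp
      ultimately show "i \<in> \<beta> k ` {1..r} \<union> inv (f k) ` {1..r}" by auto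
    qed
    then have "card {i\<in>{1..N}. g k i \<noteq> f k i} \<le> card (\<beta> k ` {1..r} \<union> inv (f k) ` {1..r})"
      by (intro card_mono) auto
    also have "\<dots> \<le> card (\<beta> k ` {1..r}) + card (inv (f k) ` {1..r})" by (rule card_Un_le)
    also have "\<dots> \<le> r + r" by (intro add_mono order.trans[OF card_image_le]) auto
    finally show ?thesis by simp
  qed

  have often: "real (card {k\<in>I. g k i \<noteq> f k i}) \<le> m" if i: "i \<in> {1..N}" for i
  proof -
    \<comment> \<open>\<open>?P\<close> covers the samples in which \<open>i\<close> is prescribed:
      for each \<open>q\<close>, either \<open>t = i\<close> as signature item or
      \<open>t = i - h - j\<close> as filler at rank \<open>j\<close>. \<open>?Q\<close> covers
      those in which \<open>i\<close> held a top rank before overwriting.\<close>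
    let ?P = "{1..r} \<times> insert i ((\<lambda>j. i - h - j) ` {1..r})"
    let ?Q = "\<Union>j\<in>{1..r}. {k\<in>I. f k i = j}"
    have "{k\<in>I. g k i \<noteq> f k i} \<subseteq> ?P \<union> ?Q"
    proof
      fix k assume k: "k \<in> {k\<in>I. g k i \<noteq> f k i}"
      then have "f k permutes {1..N}" using f(1) by (auto simp: perms_def)
      from permutes_in_image[OF this] have "f k i \<in> {1..N}" using i by simp
      moreover have "i \<in> \<beta> k ` {1..r} \<or> f k i \<le> r" using g(3)[of k i] k by force
      moreover have "k \<in> ?P" if "i \<in> \<beta> k ` {1..r}"
        using that k by (cases k) (force simp: \<beta>_def I_def split: if_splits)
      ultimately show "k \<in> ?P \<union> ?Q" using k by auto
    qed
    then have "card {k\<in>I. g k i \<noteq> f k i} \<le> card (?P \<union> ?Q)"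
      using I(1) by (intro card_mono) auto
    also have "\<dots> \<le> card ?P + card ?Q" by (rule card_Un_le)
    also have "card ?P \<le> r * (r + 1)"
    proof -
      have "card (insert i ((\<lambda>j. i - h - j) ` {1..r})) \<le> Suc (card ((\<lambda>j. i - h - j) ` {1..r}))"
        by (rule card_insert_le_m1) auto
      also have "\<dots> \<le> r + 1" using card_image_le[of "{1..r}" "\<lambda>j. i - h - j"] by simp
      finally show ?thesis unfolding card_cartesian_product by (intro mult_le_mono) auto
    qed
    also have "card ?Q \<le> (\<Sum>j\<in>{1..r}. card {k\<in>I. f k i = j})"
      by (rule card_UN_le) simp
    finally have "real (card {k\<in>I. g k i \<noteq> f k i})
        \<le> real (r * (r + 1)) + (\<Sum>j\<in>{1..r}. real (card {k\<in>I. f k i = j}))"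
      by (simp flip: of_nat_sum of_nat_add)
    also have "(\<Sum>j\<in>{1..r}. real (card {k\<in>I. f k i = j})) = (\<Sum>j\<in>{1..r}. S i j)"
      using I(1) by (intro sum.cong refl) (simp add: S_def Int_def)
    also have "\<dots> \<le> (\<Sum>j\<in>{1..r}. K * b + sqrt (K * V / s))"
      by (intro sum_mono top i)
    finally show ?thesis by (simp add: m_def V_def)
  qed
  have "1 \<in> {1..N}" using rh by auto
  \<comment> \<open>The sign of \<open>b\<close> is unknown; nonnegativity of \<open>m\<close>
    follows because it bounds a cardinality.\<close>
  then have m0: "0 \<le> m" using often[of 1] of_nat_0_le_iff order.trans by blast

  have ET: "(\<Sum>i\<in>{1..N}. \<Sum>j\<in>{1..N}. (T i j - S i j)\<^sup>2) \<le> m * (4 * real r * K)"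
    using sum_square_count_difference[OF I(1) m0 moved often] unfolding T_def S_def I(2)
    by (simp add: mult_ac)
  have scale: "frob_dist N (\<lambda>i j. A i j / K) (\<lambda>i j. B i j / K) \<le> sqrt (u / K)"
    if "(\<Sum>i\<in>{1..N}. \<Sum>j\<in>{1..N}. (A i j - B i j)\<^sup>2) \<le> K * u" for A B u
  proof -
    have "(\<Sum>i\<in>{1..N}. \<Sum>j\<in>{1..N}. (A i j / K - B i j / K)\<^sup>2)
        = (\<Sum>i\<in>{1..N}. \<Sum>j\<in>{1..N}. (A i j - B i j)\<^sup>2) / K\<^sup>2"
      by (simp add: sum_divide_distrib diff_divide_distrib[symmetric] power_divide)
    also have "\<dots> \<le> K * u / K\<^sup>2"
      using that by (intro divide_right_mono) auto
    also have "\<dots> = u / K" using K by (simp add: power2_eq_square)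
    finally show ?thesis by (simp add: frob_dist_def)
  qed
  have "frob_dist N M (first_order_matrix N lam')
      \<le> frob_dist N M (\<lambda>i j. S i j / K) + frob_dist N (\<lambda>i j. S i j / K) (\<lambda>i j. T i j / K)"
    unfolding M'[abs_def] by (rule frob_dist_triangle)
  also have "\<dots> \<le> sqrt (V / K) + sqrt (4 * real r * m / K)"
  proof (rule add_mono)
    have "frob_dist N M (\<lambda>i j. S i j / K) = frob_dist N (\<lambda>i j. K * M i j / K) (\<lambda>i j. S i j / K)"
      using K by simp
    also have "\<dots> \<le> sqrt (V / K)"
      by (rule scale) (use total in \<open>simp add: power2_commute\<close>)
    finally show "frob_dist N M (\<lambda>i j. S i j / K) \<le> sqrt (V / K)" .
    show "frob_dist N (\<lambda>i j. S i j / K) (\<lambda>i j. T i j / K) \<le> sqrt (4 * real r * m / K)"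
      by (rule scale) (use ET in \<open>simp add: power2_commute mult_ac\<close>)
  qed
  finally show ?thesis using model family size unfolding M_def V_def by blast
qed

section \<open>Multinomial logit models\<close>

text \<open>The MNL model fills the ranks from the top by successive weighted draws without replacement;
  in list form the last draws can be summed out recursively.\<close>

primrec draw_prob :: "('a \<Rightarrow> real) \<Rightarrow> 'a list \<Rightarrow> real" where
  "draw_prob w [] = 1"
| "draw_prob w (x # xs) = w x / (w x + sum_list (map w xs)) * draw_prob w xs"

lemma sum_permutations_of_set_Cons:
  assumes "finite A" "A \<noteq> {}"
  shows "sum F (permutations_of_set A) = (\<Sum>x\<in>A. \<Sum>xs\<in>permutations_of_set (A - {x}). F (x # xs))"
  unfolding permutations_of_set_nonempty[OF assms(2)]
  using assms(1) by (subst sum.UNION_disjoint) (auto simp: sum.reindex inj_on_def)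

lemma draw_prob_Cons_permutation:
  assumes "finite A" "x \<in> A" "xs \<in> permutations_of_set (A - {x})"
  shows "draw_prob w (x # xs) = w x / sum w A * draw_prob w xs"
proof -
  have "sum_list (map w xs) = sum w (A - {x})"
    using assms(3) by (simp add: permutations_of_set_def sum_list_distinct_conv_sum_set)
  then show ?thesis using assms by (simp add: sum.remove[of A x])
qed

lemma sum_draw_prob:
  assumes "finite A" "\<And>x. x \<in> A \<Longrightarrow> 0 < w x"
  shows "(\<Sum>xs\<in>permutations_of_set A. draw_prob w xs) = 1"
  using assms
proof (induction A rule: finite_psubset_induct)
  case (psubset A)
  show ?case
  proof (cases "A = {}")
    case False
    have IH: "(\<Sum>xs\<in>permutations_of_set (A - {x}). draw_prob w xs) = 1" if "x \<in> A" for x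
      using that psubset.prems by (intro psubset.IH) auto
    have "0 < sum w A" using False psubset by (intro sum_pos) auto
    have "(\<Sum>xs\<in>permutations_of_set A. draw_prob w xs)
        = (\<Sum>x\<in>A. w x / sum w A * (\<Sum>xs\<in>permutations_of_set (A - {x}). draw_prob w xs))"
      unfolding sum_permutations_of_set_Cons[OF psubset.hyps False] sum_distrib_left
      by (intro sum.cong refl draw_prob_Cons_permutation psubset.hyps)
    also have "\<dots> = (\<Sum>x\<in>A. w x / sum w A)" using IH by (intro sum.cong refl) simp
    also have "\<dots> = 1" using \<open>0 < sum w A\<close> by (simp add: sum_divide_distrib[symmetric])
    finally show ?thesis .
  qed simp
qed

text \<open>Given the first \<open>j\<close> draws, \<open>i\<close> comes next with probability
  \<open>w i\<close> over the weight of the remaining set, or 0 if it is gone. That set has exactly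
  \<open>card A - j\<close> elements, so every such conditional probability is at most
  \<open>c\<close>, and so is their average.\<close>

lemma draw_prob_nth_le:
  assumes "finite A" "\<And>x. x \<in> A \<Longrightarrow> 0 < w x" "j < card A" "0 \<le> c"
    and "\<And>B. B \<subseteq> A \<Longrightarrow> card B = card A - j \<Longrightarrow> w i \<le> c * sum w B"
  shows "(\<Sum>xs\<in>permutations_of_set A. draw_prob w xs * of_bool (xs ! j = i)) \<le> c"
  using assms
proof (induction j arbitrary: A)
  case 0
  have ne: "A \<noteq> {}" using 0 by auto
  have pos: "0 < sum w A" using ne 0 by (intro sum_pos) auto
  have "(\<Sum>xs\<in>permutations_of_set A. draw_prob w xs * of_bool (xs ! 0 = i))
      = (\<Sum>x\<in>A. w x / sum w A * of_bool (x = i) *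
          (\<Sum>xs\<in>permutations_of_set (A - {x}). draw_prob w xs))"
    unfolding sum_permutations_of_set_Cons[OF 0(1) ne] sum_distrib_left
    by (intro sum.cong refl) (simp add: draw_prob_Cons_permutation[OF 0(1)] del: draw_prob.simps)
  also have "\<dots> = (\<Sum>x\<in>A. w x / sum w A * of_bool (x = i))"
    using sum_draw_prob[of "A - {_}" w] 0 by (intro sum.cong refl) simp
  also have "\<dots> = (if i \<in> A then w i / sum w A else 0)"
    using 0(1) by (simp add: of_bool_def if_distrib cong: if_cong)
  also have "\<dots> \<le> c"
    using 0(5)[of A] 0(4) pos by (simp add: field_simps)
  finally show ?case .
next
  case (Suc j)
  have ne: "A \<noteq> {}" using Suc.prems by auto
  have pos: "0 < sum w A" using ne Suc.prems by (intro sum_pos) auto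
  have IH: "(\<Sum>xs\<in>permutations_of_set (A - {x}). draw_prob w xs * of_bool (xs ! j = i)) \<le> c"
    if x: "x \<in> A" for x
  proof (rule Suc.IH)
    fix B assume "B \<subseteq> A - {x}" "card B = card (A - {x}) - j"
    then show "w i \<le> c * sum w B"
      using Suc.prems(1) x by (intro Suc.prems(5)) auto
  qed (use Suc.prems x in auto)
  have "(\<Sum>xs\<in>permutations_of_set A. draw_prob w xs * of_bool (xs ! Suc j = i))
      = (\<Sum>x\<in>A. w x / sum w A *
          (\<Sum>xs\<in>permutations_of_set (A - {x}). draw_prob w xs * of_bool (xs ! j = i)))"
    unfolding sum_permutations_of_set_Cons[OF Suc.prems(1) ne] sum_distrib_left
    by (intro sum.cong refl)
      (simp add: draw_prob_Cons_permutation[OF Suc.prems(1)] del: draw_prob.simps)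
  also have "\<dots> \<le> (\<Sum>x\<in>A. w x / sum w A * c)"
    using Suc.prems(2) pos by (intro sum_mono mult_left_mono IH) (auto simp: less_imp_le)
  also have "\<dots> = c"
    using pos by (simp add: sum_divide_distrib[symmetric] sum_distrib_right[symmetric])
  finally show ?case .
qed

lemma draw_prob_map_upt:
  "draw_prob w (map v [a..<b]) = (\<Prod>j\<in>{a..<b}. w (v j) / (\<Sum>k\<in>{j..<b}. w (v k)))"
proof (induction "b - a" arbitrary: a)
  case (Suc n)
  then have ab: "a < b" by simp
  have "sum_list (map w (map v [Suc a..<b])) = (\<Sum>k\<in>{Suc a..<b}. w (v k))"
    by (simp add: interv_sum_list_conv_sum_set_nat comp_def)
  then show ?case
    using ab Suc.hyps(1)[of "Suc a"] Suc.hyps(2)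
    by (simp add: upt_conv_Cons[OF ab] prod.atLeast_Suc_lessThan[OF ab]
        sum.atLeast_Suc_lessThan[OF ab])
qed simp

definition ranking_list :: "nat \<Rightarrow> (nat \<Rightarrow> nat) \<Rightarrow> nat list" where
  "ranking_list N \<sigma> = map (inv \<sigma>) [1..<Suc N]"

lemma bij_betw_ranking_list:
  "bij_betw (ranking_list N) (perms N) (permutations_of_set {1..N})"
proof -
  have inj: "inj_on (ranking_list N) (perms N)"
  proof (rule inj_onI)
    fix \<sigma> \<tau> assume p: "\<sigma> \<in> perms N" "\<tau> \<in> perms N" and eq: "ranking_list N \<sigma> = ranking_list N \<tau>"
    have p': "inv \<sigma> permutes {1..N}" "inv \<tau> permutes {1..N}"
      using p permutes_inv by (auto simp: perms_def)
    have "inv \<sigma> x = inv \<tau> x" for x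
    proof (cases "x \<in> {1..N}")
      case True
      then show ?thesis using eq by (auto simp: ranking_list_def)
    next
      case False
      then show ?thesis using p' by (metis permutes_not_in)
    qed
    then show "\<sigma> = \<tau>"
      using p by (metis ext inv_inv_eq mem_Collect_eq permutes_bij perms_def)
  qed
  have "ranking_list N ` perms N \<subseteq> permutations_of_set {1..N}"
  proof
    fix xs assume "xs \<in> ranking_list N ` perms N"
    then obtain \<sigma> where \<sigma>: "\<sigma> permutes {1..N}" "xs = ranking_list N \<sigma>" by (auto simp: perms_def)
    note inv = permutes_inv[OF \<sigma>(1)]
    have "set xs = inv \<sigma> ` {1..N}"
      unfolding \<sigma>(2) ranking_list_def set_map set_upt by (simp only: atLeastLessThanSuc_atLeastAtMost)
    then show "xs \<in> permutations_of_set {1..N}"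
      using permutes_image[OF inv] inj_on_subset[OF permutes_inj[OF inv]]
      by (auto simp: permutations_of_set_def \<sigma>(2) ranking_list_def distinct_map simp del: upt_Suc)
  qed
  \<comment> \<open>Surjectivity comes from counting: both sides have \<open>fact N\<close>
    elements.\<close>
  moreover have "card (ranking_list N ` perms N) = card (permutations_of_set {1..N})"
    using card_image[OF inj] card_permutations[of "{1..N}" N] by (simp add: perms_def)
  ultimately have "ranking_list N ` perms N = permutations_of_set {1..N}"
    by (intro card_subset_eq) auto
  then show ?thesis using inj by (simp add: bij_betw_def)
qed

lemma mnl_eq_draw_prob:
  assumes "\<sigma> \<in> perms N"
  shows "mnl N w \<sigma> = draw_prob w (ranking_list N \<sigma>)"
  using assms unfolding ranking_list_def draw_prob_map_upt
  by (simp add: mnl_def atLeastLessThanSuc_atLeastAtMost)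

lemma choice_model_mnl:
  assumes "\<And>i. i \<in> {1..N} \<Longrightarrow> 0 < w i"
  shows "choice_model N (mnl N w)"
proof -
  have "0 \<le> mnl N w \<sigma>" for \<sigma>
  proof (cases "\<sigma> \<in> perms N")
    case True
    then have "inv \<sigma> permutes {1..N}" by (simp add: perms_def permutes_inv)
    then have "0 \<le> w (inv \<sigma> k)" if "k \<in> {1..N}" for k
      using that assms permutes_in_image less_imp_le by metis
    then show ?thesis
      using True by (auto simp: mnl_def intro!: prod_nonneg divide_nonneg_nonneg sum_nonneg)
  qed (simp add: mnl_def)
  moreover have "(\<Sum>\<sigma>\<in>perms N. mnl N w \<sigma>) = 1"
    using sum.reindex_bij_betw[OF bij_betw_ranking_list, of "draw_prob w" N]
      sum_draw_prob[of "{1..N}" w] assms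
    by (simp add: mnl_eq_draw_prob)
  ultimately show ?thesis by (simp add: choice_model_def mnl_def)
qed

text \<open>The largest element of \<open>B\<close> is at least \<open>card B\<close>, so its weight
  dominates that of the last index on the left; remove both and induct. This bounds from below the
  weight of any set of items still to be drawn.\<close>

lemma sum_initial_le_sum_subset:
  fixes w :: "nat \<Rightarrow> real"
  assumes "mono_on {1..N} w" "\<And>i. i \<in> {1..N} \<Longrightarrow> 0 \<le> w i" "B \<subseteq> {1..N}" "n \<le> card B"
  shows "sum w {1..n} \<le> sum w B"
  using assms(3,4)
proof (induction n arbitrary: B)
  case 0
  then show ?case using assms(2) by (auto intro!: sum_nonneg)
next
  case (Suc n)
  have fin: "finite B" using Suc.prems(1) finite_subset by blast
  then have ne: "B \<noteq> {}" using Suc.prems(2) by auto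
  define m where "m = Max B"
  have m: "m \<in> B" using fin ne by (simp add: m_def)
  have "B \<subseteq> {1..m}" using Suc.prems(1) fin by (auto simp: m_def)
  then have "card B \<le> m" using card_mono[of "{1..m}" B] by simp
  then have "w (Suc n) \<le> w m"
    using m Suc.prems by (intro mono_onD[OF assms(1)]) auto
  moreover have "sum w {1..n} \<le> sum w (B - {m})"
    using Suc.prems m fin by (intro Suc.IH) auto
  ultimately show ?case using sum.remove[OF fin m, of w] by simp
qed

text \<open>When rank \<open>j\<close> is filled, \<open>N - (j - 1)\<close> items remain, more than
  \<open>N - L\<close>. They weigh at least as much as the \<open>N - L\<close> lightest items, and
  the drawn item weighs at most \<open>w N\<close>. Rank \<open>j\<close> is list position
  \<open>j - 1\<close>.\<close>

lemma first_order_matrix_mnl_le: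
  assumes w1: "0 < w 1" and mono: "strict_mono_on {1..N} w"
    and ij: "i \<in> {1..N}" "j \<in> {1..L}" and L: "L < N"
  shows "first_order_matrix N (mnl N w) i j \<le> w N / (\<Sum>k\<in>{1..N - L}. w k)"
proof -
  have mono': "mono_on {1..N} w" using mono by (rule strict_mono_on_imp_mono_on)
  have pos: "0 < w k" if "k \<in> {1..N}" for k
    using w1 mono_onD[OF mono', of 1 k] that by auto
  define s where "s = (\<Sum>k\<in>{1..N - L}. w k)"
  have s: "0 < s" unfolding s_def using L pos by (intro sum_pos) auto
  have j: "j \<in> {1..N}" using ij L by auto
  have "first_order_matrix N (mnl N w) i j
      = (\<Sum>\<sigma>\<in>perms N. draw_prob w (ranking_list N \<sigma>) * of_bool (ranking_list N \<sigma> ! (j - 1) = i))"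
    unfolding first_order_matrix_of_bool
  proof (intro sum.cong refl)
    fix \<sigma> assume \<sigma>: "\<sigma> \<in> perms N"
    have "ranking_list N \<sigma> ! (j - 1) = inv \<sigma> j"
      using j by (auto simp: ranking_list_def nth_map simp del: upt_Suc)
    moreover have "inv \<sigma> j = i \<longleftrightarrow> \<sigma> i = j"
      using \<sigma> permutes_inverses[of \<sigma> "{1..N}"] by (auto simp: perms_def)
    ultimately show "mnl N w \<sigma> * of_bool (\<sigma> i = j)
        = draw_prob w (ranking_list N \<sigma>) * of_bool (ranking_list N \<sigma> ! (j - 1) = i)"
      by (simp add: mnl_eq_draw_prob[OF \<sigma>])
  qed
  also have "\<dots> = (\<Sum>xs\<in>permutations_of_set {1..N}. draw_prob w xs * of_bool (xs ! (j - 1) = i))"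
    by (rule sum.reindex_bij_betw[OF bij_betw_ranking_list])
  also have "\<dots> \<le> w N / s"
  proof (rule draw_prob_nth_le)
    show "0 \<le> w N / s" using pos[of N] s L by simp
    fix B assume B: "B \<subseteq> {1..N}" "card B = card {1..N} - (j - 1)"
    have "s \<le> sum w B"
      unfolding s_def using pos B ij
      by (intro sum_initial_le_sum_subset[OF mono']) (auto simp: less_imp_le)
    moreover have "w i \<le> w N" using mono_onD[OF mono', of i N] ij by auto
    moreover have "0 < w N" using pos[of N] L by simp
    ultimately have "w i * s \<le> w N * sum w B" using s by (intro mult_mono) auto
    then show "w i \<le> w N / s * sum w B" using s by (simp add: field_simps)
  qed (use pos j in auto)
  finally show ?thesis unfolding s_def .
qed

section \<open>Exponential families\<close>

lemma expfam_eq: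
  assumes "\<sigma> \<in> perms N"
  shows "expfam N \<theta> \<sigma> = exp (\<Sum>i\<in>{1..N}. \<theta> i (\<sigma> i)) / expfam_Z N \<theta>"
proof -
  have "(\<Sum>j\<in>{1..N}. \<theta> i j * (if \<sigma> i = j then 1 else 0)) = \<theta> i (\<sigma> i)" if "i \<in> {1..N}" for i
    using that assms permutes_in_image[of \<sigma> "{1..N}" i]
    by (simp add: perms_def if_distrib cong: if_cong)
  then show ?thesis using assms by (simp add: expfam_def)
qed

lemma expfam_Z_pos: "0 < expfam_Z N \<theta>"
proof -
  have "id \<in> perms N" by (simp add: perms_def permutes_id)
  then show ?thesis unfolding expfam_Z_def by (intro sum_pos finite_perms) auto
qed

lemma choice_model_expfam: "choice_model N (expfam N \<theta>)"
proof -
  have "(\<Sum>\<sigma>\<in>perms N. expfam N \<theta> \<sigma>) = expfam_Z N \<theta> / expfam_Z N \<theta>"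
    by (simp add: expfam_def expfam_Z_def flip: sum_divide_distrib)
  then show ?thesis
    using expfam_Z_pos[of N \<theta>] by (simp add: choice_model_def expfam_def less_imp_le)
qed

text \<open>Exchanging the item at rank \<open>j\<close> with each of the \<open>N\<close> items in turn changes the probability
  by a factor of at most \<open>R\<close>, so no item can hold rank \<open>j\<close> with probability above \<open>R / N\<close>.\<close>

lemma first_order_matrix_expfam_le:
  fixes \<theta> :: "nat \<Rightarrow> nat \<Rightarrow> real"
  assumes R: "1 \<le> R" and ij: "i \<in> {1..N}" "j \<in> {1..N}"
    and \<theta>: "\<And>a b. a \<in> {1..N} \<Longrightarrow> b \<in> {1..N} \<Longrightarrow> a \<noteq> i \<Longrightarrow> b \<noteq> j \<Longrightarrow>
      exp (\<theta> i j + \<theta> a b) / exp (\<theta> a j + \<theta> i b) \<le> R"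
  shows "first_order_matrix N (expfam N \<theta>) i j \<le> R / real N"
proof -
  let ?P = "expfam N \<theta>" and ?M = "first_order_matrix N (expfam N \<theta>)"
  define t where "t a = Transposition.transpose i a" for a
  have swap: "\<sigma> \<circ> t a \<in> perms N" if "\<sigma> \<in> perms N" "a \<in> {1..N}" for \<sigma> a
    using that ij by (auto simp: perms_def t_def intro!: permutes_compose permutes_swap_id)
  have le: "?P \<sigma> \<le> R * ?P (\<sigma> \<circ> t a)"
    if \<sigma>: "\<sigma> \<in> perms N" and a: "a \<in> {1..N}" and \<sigma>i: "\<sigma> i = j" for \<sigma> a
  proof (cases "a = i")
    \<comment> \<open>The hypothesis on \<theta> is silent about \<open>a = i\<close>; this case
      rests on \<open>1 \<le> R\<close>.\<close>
    case True
    then have "\<sigma> \<circ> t a = \<sigma>" by (simp add: t_def)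
    moreover have "0 \<le> ?P \<sigma>" using choice_model_expfam by (simp add: choice_model_def)
    ultimately show ?thesis using mult_right_mono[OF R, of "?P \<sigma>"] by simp
  next
    case False
    have perm: "\<sigma> permutes {1..N}" using \<sigma> by (simp add: perms_def)
    have "\<sigma> a \<noteq> j" using False \<sigma>i inj_eq[OF permutes_inj[OF perm]] by auto
    moreover have "\<sigma> a \<in> {1..N}" using permutes_in_image[OF perm] a by simp
    ultimately have "exp (\<theta> i j + \<theta> a (\<sigma> a)) / exp (\<theta> a j + \<theta> i (\<sigma> a)) \<le> R"
      using \<theta> a False by blast
    then have R': "exp (\<theta> i j + \<theta> a (\<sigma> a)) \<le> R * exp (\<theta> a j + \<theta> i (\<sigma> a))"
      by (simp add: divide_le_eq)
    have split: "(\<Sum>x\<in>{1..N}. F x) = F i + F a + (\<Sum>x\<in>{1..N} - {i, a}. F x)"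
      for F :: "nat \<Rightarrow> real"
      using ij a False sum.remove[of "{1..N}" i F] sum.remove[of "{1..N} - {i}" a F]
      by (simp add: Diff_insert2[symmetric] insert_commute)
    \<comment> \<open>Only the rows \<open>i\<close> and \<open>a\<close> feel the exchange; all
      other rows contribute the common factor \<open>exp q\<close>.\<close>
    define q where "q = (\<Sum>x\<in>{1..N} - {i, a}. \<theta> x (\<sigma> x))"
    have "(\<Sum>x\<in>{1..N} - {i, a}. \<theta> x ((\<sigma> \<circ> t a) x)) = q"
      unfolding q_def by (intro sum.cong refl) (auto simp: t_def Transposition.transpose_def)
    then have s2: "(\<Sum>x\<in>{1..N}. \<theta> x ((\<sigma> \<circ> t a) x)) = \<theta> a j + \<theta> i (\<sigma> a) + q"
      unfolding split using \<sigma>i by (simp add: t_def)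
    have s1: "(\<Sum>x\<in>{1..N}. \<theta> x (\<sigma> x)) = \<theta> i j + \<theta> a (\<sigma> a) + q"
      unfolding split q_def using \<sigma>i by simp
    have "?P \<sigma> = exp (\<theta> i j + \<theta> a (\<sigma> a)) * exp q / expfam_Z N \<theta>"
      unfolding expfam_eq[OF \<sigma>] s1 by (simp add: exp_add)
    also have "\<dots> \<le> R * exp (\<theta> a j + \<theta> i (\<sigma> a)) * exp q / expfam_Z N \<theta>"
      using R' expfam_Z_pos[of N \<theta>] by (intro divide_right_mono mult_right_mono) auto
    also have "\<dots> = R * ?P (\<sigma> \<circ> t a)"
      unfolding expfam_eq[OF swap[OF \<sigma> a]] s2 by (simp add: exp_add)
    finally show ?thesis .
  qed
  \<comment> \<open>Composition with \<open>t a\<close> is an involution of \<open>perms N\<close>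
    carrying the event that \<open>i\<close> has rank \<open>j\<close> to the event that
    \<open>a\<close> has it.\<close>
  have row: "?M i j \<le> R * ?M a j" if a: "a \<in> {1..N}" for a
  proof -
    have "?M i j \<le> (\<Sum>\<sigma>\<in>perms N. R * (?P (\<sigma> \<circ> t a) * of_bool ((\<sigma> \<circ> t a) a = j)))"
      unfolding first_order_matrix_of_bool
      using le[OF _ a] by (intro sum_mono) (auto simp: t_def)
    also have "\<dots> = R * (\<Sum>\<sigma>\<in>perms N. ?P (\<sigma> \<circ> t a) * of_bool ((\<sigma> \<circ> t a) a = j))"
      by (simp add: sum_distrib_left)
    also have "(\<Sum>\<sigma>\<in>perms N. ?P (\<sigma> \<circ> t a) * of_bool ((\<sigma> \<circ> t a) a = j)) = ?M a j"
      unfolding first_order_matrix_of_bool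
    proof (rule sum.reindex_bij_witness[of _ "\<lambda>\<sigma>. \<sigma> \<circ> t a" "\<lambda>\<sigma>. \<sigma> \<circ> t a"])
    qed (use swap[OF _ a] in \<open>auto simp: t_def comp_assoc\<close>)
    finally show ?thesis .
  qed
  have "real N * ?M i j = (\<Sum>a\<in>{1..N}. ?M i j)" by simp
  also have "\<dots> \<le> (\<Sum>a\<in>{1..N}. R * ?M a j)" by (intro sum_mono row)
  also have "\<dots> = R"
    unfolding sum_distrib_left[symmetric]
    using first_order_matrix_column_sum[OF choice_model_expfam ij(2)] by simp
  finally show ?thesis using ij by (simp add: field_simps)
qed

section \<open>The approximation theorem\<close>

text \<open>The error falls with the number of samples outside \<open>m\<close> and grows with it
  inside. So \<open>K\<close> is a lower bound for that number, while \<open>m\<close> contains the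
  upper bound \<open>r * x / 2\<close>. With \<open>s = sqrt x\<close>, \<open>m\<close> is of order
  \<open>x powr (3/4)\<close> and the second root vanishes in the limit.\<close>

lemma signature_approximation_error_tendsto:
  fixes r :: real
  assumes "0 < r"
  defines "K \<equiv> \<lambda>x. r * (x - r - 1) / 2"
  defines "m \<equiv> \<lambda>x. r * (r + 1) + r * (r * x / 2 * (sqrt (ln x) / x)
    + sqrt (r * x / 2 * (x + sqrt x * r) / sqrt x))"
  shows "((\<lambda>x. sqrt ((x + sqrt x * r) / K x) + sqrt (4 * r * m x / K x)) \<longlongrightarrow> sqrt (2 / r)) at_top"
proof -
  have "((\<lambda>x. sqrt ((x + sqrt x * r) / K x) + sqrt (4 * r * m x / K x))
      \<longlongrightarrow> (2 / r) powr (1 / 2)) at_top"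
    unfolding K_def m_def using assms(1) by real_asymp
  then show ?thesis using assms(1) by (simp add: powr_half_sqrt)
qed

lemma eventually_signature_approximation:
  fixes \<epsilon> :: real
  assumes "0 < \<epsilon>" "\<epsilon> < 1/2"
  shows "\<exists>r. \<forall>\<^sub>F N in sequentially. \<forall>lam. choice_model N lam \<longrightarrow>
    (\<forall>i\<in>{1..N}. \<forall>j\<in>{1..r}. first_order_matrix N lam i j \<le> sqrt (ln (real N)) / real N) \<longrightarrow>
    (\<exists>lam'. choice_model N lam' \<and> signature_family N lam' \<and>
      frob_dist N (first_order_matrix N lam) (first_order_matrix N lam') \<le> \<epsilon> \<and>
      real (support_size N lam') \<le> 4 * real N / \<epsilon>\<^sup>2)"
proof -
  \<comment> \<open>The upper bound on \<open>r\<close> serves the support size, the lower bound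
    \<open>2 / \<epsilon>\<^sup>2\<close> the sampling error; since
    \<open>1 / \<epsilon>\<^sup>2\<close> exceeds 4, rounding down keeps both.\<close>
  define r where "r = nat \<lfloor>8 / \<epsilon>\<^sup>2\<rfloor>"
  have "\<epsilon>\<^sup>2 < (1/2)\<^sup>2" using assms by (intro power_strict_mono) auto
  then have "4 < 1 / \<epsilon>\<^sup>2" using assms by (simp add: field_simps power2_eq_square)
  moreover have "8 / \<epsilon>\<^sup>2 - 1 \<le> real r" "real r \<le> 8 / \<epsilon>\<^sup>2" using assms by (auto simp: r_def)
  ultimately have r: "2 / \<epsilon>\<^sup>2 < real r" "real r \<le> 8 / \<epsilon>\<^sup>2" by (auto simp: field_simps)
  have r0: "0 < real r" using r(1) assms by (smt (verit) divide_pos_pos zero_less_power)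
  have "2 / real r < \<epsilon>\<^sup>2" using r(1) r0 assms by (simp add: field_simps)
  then have "sqrt (2 / real r) < \<epsilon>" using assms by (metis real_sqrt_less_iff real_sqrt_unique less_imp_le)
  define K m where "K = (\<lambda>x. real r * (x - real r - 1) / 2)"
    and "m = (\<lambda>x. real r * (real r + 1) + real r * (real r * x / 2 * (sqrt (ln x) / x)
      + sqrt (real r * x / 2 * (x + sqrt x * real r) / sqrt x)))"
  have "\<forall>\<^sub>F x in at_top. sqrt ((x + sqrt x * real r) / K x) + sqrt (4 * real r * m x / K x) < \<epsilon>"
    using order_tendstoD(2)[OF signature_approximation_error_tendsto[OF r0]
        \<open>sqrt (2 / real r) < \<epsilon>\<close>] unfolding K_def m_def .
  then have "\<forall>\<^sub>F N in sequentially. sqrt ((real N + sqrt (real N) * real r) / K (real N))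
      + sqrt (4 * real r * m (real N) / K (real N)) < \<epsilon>"
    by (rule eventually_compose_filterlim[OF _ filterlim_real_sequentially])
  then have "\<forall>\<^sub>F N in sequentially. \<forall>lam. choice_model N lam \<longrightarrow>
    (\<forall>i\<in>{1..N}. \<forall>j\<in>{1..r}. first_order_matrix N lam i j \<le> sqrt (ln (real N)) / real N) \<longrightarrow>
    (\<exists>lam'. choice_model N lam' \<and> signature_family N lam' \<and>
      frob_dist N (first_order_matrix N lam) (first_order_matrix N lam') \<le> \<epsilon> \<and>
      real (support_size N lam') \<le> 4 * real N / \<epsilon>\<^sup>2)"
    using eventually_ge_at_top[of "r + 2"]
  proof eventually_elim
    case (elim N)
    \<comment> \<open>This is the largest \<open>h\<close> with \<open>2 * h + r \<le> N\<close>;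
      the rounding accounts for the \<open>- 1\<close> in \<open>K\<close>.\<close>
    define h where "h = (N - r) div 2"
    define b where "b = sqrt (ln (real N)) / real N"
    define k where "k = real (r * h)"
    \<comment> \<open>Any growth of \<open>s\<close> strictly between constant and linear would do:
      \<open>s * r\<close> must be negligible against \<open>N\<close>, and \<open>N / s\<close>
      must be too.\<close>
    define s where "s = sqrt (real N)"
    have N: "0 < real N" "1 \<le> real N" using elim(2) by auto
    have s: "0 < s" using N by (simp add: s_def)
    have "real (r + 2 * h) \<le> real N" "real N \<le> real (r + 2 * h + 1)"
      unfolding of_nat_le_iff using elim(2) by (auto simp: h_def)
    then have h: "(real N - real r - 1) / 2 \<le> real h" "real h \<le> real N / 2" by auto
    have kl: "K (real N) \<le> k" using mult_left_mono[OF h(1), of "real r"] by (simp add: k_def K_def)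
    have ku: "k \<le> real r * real N / 2" using mult_left_mono[OF h(2), of "real r"] by (simp add: k_def)
    have K0: "0 < K (real N)" using elim(2) r0 by (auto simp: K_def)
    have b0: "0 \<le> b" using N by (simp add: b_def)
    let ?m = "real (r * (r + 1)) + real r * (k * b + sqrt (k * (real N + s * real r) / s))"
    have m: "?m \<le> m (real N)"
    proof -
      have "k * b \<le> real r * real N / 2 * b" using ku b0 by (rule mult_right_mono)
      moreover have "k * (real N + s * real r) / s \<le> real r * real N / 2 * (real N + s * real r) / s"
        using ku s by (intro divide_right_mono mult_right_mono) auto
      ultimately have "k * b + sqrt (k * (real N + s * real r) / s)
          \<le> real r * real N / 2 * b + sqrt (real r * real N / 2 * (real N + s * real r) / s)"
        by (intro add_mono) auto
      from add_left_mono[OF mult_left_mono[OF this], of "real r" "real (r * (r + 1))"]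
      show ?thesis
        by (simp only: m_def b_def s_def of_nat_mult of_nat_add of_nat_1 of_nat_0_le_iff)
    qed
    have m0: "0 \<le> m (real N)"
      unfolding m_def using N by (intro add_nonneg_nonneg mult_nonneg_nonneg) auto
    have e1: "sqrt ((real N + s * real r) / k) \<le> sqrt ((real N + s * real r) / K (real N))"
      using kl K0 s by (intro real_sqrt_le_mono divide_left_mono) auto
    have e2: "sqrt (4 * real r * ?m / k) \<le> sqrt (4 * real r * m (real N) / K (real N))"
    proof -
      have "4 * real r * ?m / k \<le> 4 * real r * m (real N) / k"
        using m kl K0 by (intro divide_right_mono mult_left_mono) auto
      also have "\<dots> \<le> 4 * real r * m (real N) / K (real N)"
        using kl K0 m0 by (intro divide_left_mono) auto
      finally show ?thesis by simp
    qed
    show ?case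
    proof (intro allI impI)
      fix lam assume lam: "choice_model N lam"
        and col: "\<forall>i\<in>{1..N}. \<forall>j\<in>{1..r}. first_order_matrix N lam i j \<le> sqrt (ln (real N)) / real N"
      have rh: "0 < r" "0 < h" "2 * h + r \<le> N" using r0 elim(2) by (auto simp: h_def)
      obtain lam' where lam': "choice_model N lam'" "signature_family N lam'"
          "support_size N lam' = r * h"
          "frob_dist N (first_order_matrix N lam) (first_order_matrix N lam')
            \<le> sqrt ((real N + s * real r) / k) + sqrt (4 * real r * ?m / k)"
        using signature_approximation[OF lam rh s, of b] col unfolding b_def[symmetric] k_def by blast
      have "real (support_size N lam') \<le> 8 / \<epsilon>\<^sup>2 * (real N / 2)"
        unfolding lam'(3) of_nat_mult using r(2) h(2) by (intro mult_mono) auto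
      then have "real (support_size N lam') \<le> 4 * real N / \<epsilon>\<^sup>2" by simp
      moreover have "frob_dist N (first_order_matrix N lam) (first_order_matrix N lam') \<le> \<epsilon>"
        using lam'(4) e1 e2 elim(1) unfolding s_def by linarith
      ultimately show "\<exists>lam'. choice_model N lam' \<and> signature_family N lam' \<and>
          frob_dist N (first_order_matrix N lam) (first_order_matrix N lam') \<le> \<epsilon> \<and>
          real (support_size N lam') \<le> 4 * real N / \<epsilon>\<^sup>2"
        using lam'(1,2) by blast
    qed
  qed
  then show ?thesis by blast
qed

theorem theorem3p3:
  fixes \<delta> \<epsilon> :: real
  assumes "0 < \<delta>" "\<delta> < 1" "0 < \<epsilon>" "\<epsilon> < 1/2"
  shows "\<exists>N0::nat. \<forall>N\<ge>N0. \<forall>(D :: nat \<Rightarrow> nat \<Rightarrow> real) lam.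
    (let L = nat \<lfloor>real N powr \<delta>\<rfloor> in
      (\<exists>w :: nat \<Rightarrow> real. 0 < w 1 \<and> strict_mono_on {1..N} w
          \<and> w N / (\<Sum>k\<in>{1..N - L}. w k) \<le> sqrt (ln (real N)) / real N
          \<and> lam = mnl N w)
    \<or> (\<exists>\<theta> :: nat \<Rightarrow> nat \<Rightarrow> real.
          (\<forall>p1\<in>{1..N}\<times>{1..N}. \<forall>p2\<in>{1..N}\<times>{1..N}. \<forall>p3\<in>{1..N}\<times>{1..N}. \<forall>p4\<in>{1..N}\<times>{1..N}.
             distinct [p1, p2, p3, p4] \<longrightarrow>
             exp (\<theta> (fst p1) (snd p1) + \<theta> (fst p2) (snd p2))
               / exp (\<theta> (fst p3) (snd p3) + \<theta> (fst p4) (snd p4)) \<le> sqrt (ln (real N)))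
          \<and> lam = expfam N \<theta>))
    \<longrightarrow> frob_dist N D (first_order_matrix N lam) \<le> \<epsilon>
    \<longrightarrow> (\<exists>lam_hat. choice_model N lam_hat \<and> signature_family N lam_hat
          \<and> frob_dist N D (first_order_matrix N lam_hat) \<le> 2 * \<epsilon>
          \<and> real (support_size N lam_hat) \<le> 4 * real N / \<epsilon>^2)"
proof -
  obtain r where approx: "\<forall>\<^sub>F N in sequentially. \<forall>lam. choice_model N lam \<longrightarrow>
    (\<forall>i\<in>{1..N}. \<forall>j\<in>{1..r}. first_order_matrix N lam i j \<le> sqrt (ln (real N)) / real N) \<longrightarrow>
    (\<exists>lam'. choice_model N lam' \<and> signature_family N lam' \<and>
      frob_dist N (first_order_matrix N lam) (first_order_matrix N lam') \<le> \<epsilon> \<and>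
      real (support_size N lam') \<le> 4 * real N / \<epsilon>\<^sup>2)"
    using eventually_signature_approximation[OF assms(3,4)] by blast
  \<comment> \<open>The first bound gives \<open>r \<le> L\<close>, so that the MNL estimate reaches
    all \<open>r\<close> top ranks; the second makes the exponential family ratio at least
    1.\<close>
  have large: "\<forall>\<^sub>F N in sequentially. real r + 1 \<le> real N powr \<delta>"
      "\<forall>\<^sub>F N in sequentially. 1 \<le> ln (real N)"
    using assms(1) by real_asymp+
  have "\<forall>\<^sub>F N in sequentially. \<forall>(D :: nat \<Rightarrow> nat \<Rightarrow> real) lam.
    (let L = nat \<lfloor>real N powr \<delta>\<rfloor> in
      (\<exists>w :: nat \<Rightarrow> real. 0 < w 1 \<and> strict_mono_on {1..N} w
          \<and> w N / (\<Sum>k\<in>{1..N - L}. w k) \<le> sqrt (ln (real N)) / real N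
          \<and> lam = mnl N w)
    \<or> (\<exists>\<theta> :: nat \<Rightarrow> nat \<Rightarrow> real.
          (\<forall>p1\<in>{1..N}\<times>{1..N}. \<forall>p2\<in>{1..N}\<times>{1..N}. \<forall>p3\<in>{1..N}\<times>{1..N}. \<forall>p4\<in>{1..N}\<times>{1..N}.
             distinct [p1, p2, p3, p4] \<longrightarrow>
             exp (\<theta> (fst p1) (snd p1) + \<theta> (fst p2) (snd p2))
               / exp (\<theta> (fst p3) (snd p3) + \<theta> (fst p4) (snd p4)) \<le> sqrt (ln (real N)))
          \<and> lam = expfam N \<theta>))
    \<longrightarrow> frob_dist N D (first_order_matrix N lam) \<le> \<epsilon>
    \<longrightarrow> (\<exists>lam_hat. choice_model N lam_hat \<and> signature_family N lam_hat
          \<and> frob_dist N D (first_order_matrix N lam_hat) \<le> 2 * \<epsilon>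
          \<and> real (support_size N lam_hat) \<le> 4 * real N / \<epsilon>^2)"
    using approx large eventually_gt_at_top[of "r + 1"]
  proof eventually_elim
    case (elim N)
    define L where "L = nat \<lfloor>real N powr \<delta>\<rfloor>"
    have rL: "r \<le> L" using elim(2) unfolding L_def by (simp add: le_nat_iff le_floor_iff)
    have "real N powr \<delta> < real N powr 1" using assms(2) elim(4) by (intro powr_less_mono) auto
    then have LN: "L < N" unfolding L_def using elim(4) by (simp add: nat_less_iff floor_less_iff)
    have mnl_case: "choice_model N lam \<and>
        (\<forall>i\<in>{1..N}. \<forall>j\<in>{1..r}. first_order_matrix N lam i j \<le> sqrt (ln (real N)) / real N)"
      if w: "0 < w 1" "strict_mono_on {1..N} w"
        "w N / (\<Sum>k\<in>{1..N - L}. w k) \<le> sqrt (ln (real N)) / real N" "lam = mnl N w" for w lam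
    proof (intro conjI ballI)
      have "w 1 \<le> w i" if "i \<in> {1..N}" for i
        using mono_onD[OF strict_mono_on_imp_mono_on[OF w(2)], of 1 i] that by auto
      then show "choice_model N lam"
        unfolding w(4) using w(1) by (intro choice_model_mnl) force
      show "first_order_matrix N lam i j \<le> sqrt (ln (real N)) / real N"
        if "i \<in> {1..N}" "j \<in> {1..r}" for i j
        unfolding w(4) using that rL w(3)
        by (intro order.trans[OF first_order_matrix_mnl_le[OF w(1,2) _ _ LN]]) auto
    qed
    have expfam_case: "choice_model N lam \<and>
        (\<forall>i\<in>{1..N}. \<forall>j\<in>{1..r}. first_order_matrix N lam i j \<le> sqrt (ln (real N)) / real N)"
      if \<theta>: "\<forall>p1\<in>{1..N}\<times>{1..N}. \<forall>p2\<in>{1..N}\<times>{1..N}. \<forall>p3\<in>{1..N}\<times>{1..N}. \<forall>p4\<in>{1..N}\<times>{1..N}.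
             distinct [p1, p2, p3, p4] \<longrightarrow>
             exp (\<theta> (fst p1) (snd p1) + \<theta> (fst p2) (snd p2))
               / exp (\<theta> (fst p3) (snd p3) + \<theta> (fst p4) (snd p4)) \<le> sqrt (ln (real N))"
        and lam: "lam = expfam N \<theta>" for \<theta> lam
    proof (intro conjI ballI)
      show "choice_model N lam" unfolding lam by (rule choice_model_expfam)
      fix i j assume ij: "i \<in> {1..N}" "j \<in> {1..r}"
      have j: "j \<in> {1..N}" using ij elim(4) by auto
      show "first_order_matrix N lam i j \<le> sqrt (ln (real N)) / real N"
        unfolding lam
      proof (rule first_order_matrix_expfam_le)
        show "1 \<le> sqrt (ln (real N))" using elim(3) by simp
        fix a b assume ab: "a \<in> {1..N}" "b \<in> {1..N}" "a \<noteq> i" "b \<noteq> j"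
        \<comment> \<open>The exchange compares only the corners of a rectangle with two different
          rows and two different columns.\<close>
        have "distinct [(i, j), (a, b), (a, j), (i, b)]" using ab by auto
        then show "exp (\<theta> i j + \<theta> a b) / exp (\<theta> a j + \<theta> i b) \<le> sqrt (ln (real N))"
          using \<theta>[rule_format, of "(i, j)" "(a, b)" "(a, j)" "(i, b)"] ij(1) j ab by simp
      qed (use ij j in auto)
    qed
    show ?case
      unfolding Let_def L_def[symmetric]
    proof (intro allI impI)
      fix D lam
      assume "(\<exists>w :: nat \<Rightarrow> real. 0 < w 1 \<and> strict_mono_on {1..N} w
          \<and> w N / (\<Sum>k\<in>{1..N - L}. w k) \<le> sqrt (ln (real N)) / real N
          \<and> lam = mnl N w)
        \<or> (\<exists>\<theta> :: nat \<Rightarrow> nat \<Rightarrow> real.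
          (\<forall>p1\<in>{1..N}\<times>{1..N}. \<forall>p2\<in>{1..N}\<times>{1..N}. \<forall>p3\<in>{1..N}\<times>{1..N}. \<forall>p4\<in>{1..N}\<times>{1..N}.
             distinct [p1, p2, p3, p4] \<longrightarrow>
             exp (\<theta> (fst p1) (snd p1) + \<theta> (fst p2) (snd p2))
               / exp (\<theta> (fst p3) (snd p3) + \<theta> (fst p4) (snd p4)) \<le> sqrt (ln (real N)))
          \<and> lam = expfam N \<theta>)"
        and D: "frob_dist N D (first_order_matrix N lam) \<le> \<epsilon>"
      then have "choice_model N lam \<and>
          (\<forall>i\<in>{1..N}. \<forall>j\<in>{1..r}. first_order_matrix N lam i j \<le> sqrt (ln (real N)) / real N)"
        using mnl_case expfam_case by (elim disjE exE conjE) blast+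
      then obtain lam' where lam': "choice_model N lam'" "signature_family N lam'"
          "frob_dist N (first_order_matrix N lam) (first_order_matrix N lam') \<le> \<epsilon>"
          "real (support_size N lam') \<le> 4 * real N / \<epsilon>\<^sup>2"
        using elim(1) by blast
      moreover have "frob_dist N D (first_order_matrix N lam') \<le> 2 * \<epsilon>"
        using frob_dist_triangle[of N D "first_order_matrix N lam'" "first_order_matrix N lam"]
          D lam'(3) by linarith
      ultimately show "\<exists>lam_hat. choice_model N lam_hat \<and> signature_family N lam_hat
          \<and> frob_dist N D (first_order_matrix N lam_hat) \<le> 2 * \<epsilon>
          \<and> real (support_size N lam_hat) \<le> 4 * real N / \<epsilon>^2" by blast
    qed
  qed
  then show ?thesis unfolding eventually_sequentially .
qed

end
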